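(* For $n\ge1$ let $g_n$ be the sum, over all Motzkin words $w$ of length $n$, of the last symbol of $w$. Then $$\sum_{n\ge1}g_nx^n=\frac{1 - x - 2 x^2-\sqrt{1 - 2 x - 3 x^2}}{2 x^2},$$ and, as $n\to\infty$, $$g_n\sim\frac{3 \sqrt{3}\, \left(\frac{1}{n}\right)^{3/2} 3^n}{2 \sqrt{\pi}}.$$
   Context: A Motzkin word of length $n\ge 1$ is a word $w=w_1\cdots w_n$ over the positive integers such that $w_1=1$, and $1\le w_k\le w_{k-1}+1$ and $w_{k-1}\ne w_k$ for $k=2,\dots,n$. Its last symbol is $w_n$. *)

theory Defs
  imports
    "HOL-Analysis.Analysis"
    "HOL-Library.Landau_Symbols"
    "HOL-Computational_Algebra.Computational_Algebra"
begin

text \<open>List positions are numbered from 0, so \<open>w ! k\<close> is the symbol $w_{k+1}$.\<close>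

definition motzkin_word :: "nat list \<Rightarrow> bool" where
  "motzkin_word w \<longleftrightarrow> w \<noteq> [] \<and> w ! 0 = 1 \<and>
     (\<forall>k. 1 \<le> k \<and> k < length w \<longrightarrow>
        1 \<le> w ! k \<and> w ! k \<le> w ! (k - 1) + 1 \<and> w ! (k - 1) \<noteq> w ! k)"

definition motzkin_words :: "nat \<Rightarrow> nat list set" where
  "motzkin_words n = {w. motzkin_word w \<and> length w = n}"

definition last_symbol_sum :: "nat \<Rightarrow> nat" where
  "last_symbol_sum n = (\<Sum>w\<in>motzkin_words n. last w)"

text \<open>The sum above is a genuine finite sum.\<close>

lemma finite_motzkin_words: "finite (motzkin_words n)"
proof -
  have bound: "k < length w \<Longrightarrow> w ! k \<le> Suc k" if "motzkin_word w" for w k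
  proof (induction k)
    case 0
    then show ?case using that by (simp add: motzkin_word_def)
  next
    case (Suc k)
    have "w ! Suc k \<le> w ! k + 1"
      using that Suc.prems unfolding motzkin_word_def by (metis diff_Suc_1 le_add1 plus_1_eq_Suc)
    with Suc show ?case by simp
  qed
  have "motzkin_words n \<subseteq> {w. set w \<subseteq> {..n} \<and> length w = n}"
    using bound by (fastforce simp: motzkin_words_def in_set_conv_nth)
  then show ?thesis
    by (rule finite_subset) (simp add: finite_lists_length_eq)
qed

definition last_symbol_gf :: "real fps" where
  "last_symbol_gf = Abs_fps (\<lambda>n. if n \<ge> 1 then of_nat (last_symbol_sum n) else 0)"

text \<open>The power series square root of $1 - 2x - 3x^2$ with constant term 1.\<close>

definition motzkin_sqrt :: "real fps" where
  "motzkin_sqrt = fps_radical root 2 (1 - 2 * fps_X - 3 * fps_X ^ 2)"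

lemma motzkin_sqrt_square: "motzkin_sqrt ^ 2 = 1 - 2 * fps_X - 3 * fps_X ^ 2"
  and motzkin_sqrt_nth_0: "fps_nth motzkin_sqrt 0 = 1"
  using power_radical[of "1 - 2 * fps_X - 3 * fps_X ^ 2 :: real fps" root 1]
  by (simp_all add: motzkin_sqrt_def numeral_2_eq_2)

end

theory Submission
  imports Defs "HOL-Real_Asymp.Real_Asymp"
begin

text \<open>
  The sum $g_n$ is the Motzkin number $M_n$ for every $n \ge 1$. Write $M(x)$ for the series with
  $\sqrt{1 - 2x - 3x^2} = 1 - x - 2x^2 M(x)$, so that $M = 1 + xM + x^2M^2$.

  To see the connection, let $C_i(x)$ count by length the ways to continue a Motzkin word whose
  last symbol is $i$. The next symbol $j$ ranges over $\{1, \dots, i+1\} \setminus \{i\}$, hence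
  $C_i = 1 + x \sum_j C_j$. Subtracting consecutive equations gives a linear recurrence in $i$,
  $C_i - C_{i-1} = x (C_{i+1} - C_i + C_{i-1})$, whose characteristic root that is a power series is
  $r = 1 + xM$; the equation for $i = 1$ then forces $C_i = M r^{i-1}$. A geometric sum verifies
  that this formula solves the system (lemma \<open>continuation_fps_recursion\<close>).

  The sum of $[x^n] C_{w_m}$ over all Motzkin words $w$ of length $m$ depends only on $m + n$,
  because appending one symbol trades one unit of $n$ for one unit of $m$. There is only one word
  of length 1, so the sum is $[x^{m+n-1}] M$ (lemma \<open>sum_continuations\<close>). A last symbol $i$ has
  exactly $i$ possible successors, that is $[x^1] C_i = i$, and so $n = 1$ gives $g_m = [x^m] M$.

  For the asymptotics, factor $\sqrt{1 - 2x - 3x^2} = \sqrt{1 + x} \sqrt{1 - 3x}$. After division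
  by $3^n$ the coefficients are a convolution of $(-1)^n \binom{1/2}{n}$, which is asymptotic to
  $-n^{-3/2} / (2\sqrt\pi)$, with the geometrically decreasing sequence $\binom{1/2}{k} 3^{-k}$.
  Dominated convergence (lemma \<open>tendsto_powr_convolution\<close>) shows that such a convolution inherits
  the power law of the first factor, multiplied by the sum of the second, here
  $\sqrt{1 + 1/3} = 2/\sqrt 3$.
\<close>

section \<open>The generating function of the Motzkin numbers\<close>

definition motzkin_fps :: "real fps" where
  "motzkin_fps = fps_const (1/2) * fps_shift 2 (1 - fps_X - motzkin_sqrt)"

lemma motzkin_sqrt_nth_1: "fps_nth motzkin_sqrt 1 = -1"
proof -
  have "fps_nth (motzkin_sqrt ^ 2) 1 = -2"
    unfolding motzkin_sqrt_square by (simp add: numeral_fps_const)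
  then show ?thesis
    by (simp add: power2_eq_square fps_mult_nth motzkin_sqrt_nth_0)
qed

text \<open>
  The shift in the definition of \<open>motzkin_fps\<close> is a genuine division by $x^2$, because
  \<open>motzkin_sqrt\<close> begins with $1 - x$.
\<close>

lemma motzkin_sqrt_conv_motzkin_fps:
  "motzkin_sqrt = 1 - fps_X - 2 * fps_X ^ 2 * motzkin_fps"
proof -
  have "2 * fps_X ^ 2 * motzkin_fps = fps_X ^ 2 * fps_shift 2 (1 - fps_X - motzkin_sqrt)"
  proof -
    have "2 * fps_const (1/2) = (1 :: real fps)"
      by (simp add: numeral_fps_const)
    then show ?thesis
      unfolding motzkin_fps_def by algebra
  qed
  also have "\<dots> = 1 - fps_X - motzkin_sqrt"
  proof (rule fps_ext)
    fix n :: nat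
    consider "n = 0" | "n = 1" | m where "n = m + 2"
      by (metis One_nat_def add_2_eq_Suc' not0_implies_Suc)
    then show "fps_nth (fps_X ^ 2 * fps_shift 2 (1 - fps_X - motzkin_sqrt)) n
        = fps_nth (1 - fps_X - motzkin_sqrt) n"
      by cases (use motzkin_sqrt_nth_0 motzkin_sqrt_nth_1 in
          \<open>auto simp: fps_X_power_mult_nth\<close>)
  qed
  finally show ?thesis by simp
qed

text \<open>Squaring the preceding identity gives $4x^2$ times the functional equation.\<close>

lemma motzkin_fps_equation:
  "motzkin_fps = 1 + fps_X * motzkin_fps + fps_X ^ 2 * motzkin_fps ^ 2"
proof -
  let ?M = motzkin_fps and ?X = "fps_X :: real fps"
  have "(1 - ?X - 2 * ?X ^ 2 * ?M) ^ 2 = 1 - 2 * ?X - 3 * ?X ^ 2"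
    using motzkin_sqrt_square by (simp flip: motzkin_sqrt_conv_motzkin_fps)
  then have "(4 * ?X ^ 2) * (1 + ?X * ?M + ?X ^ 2 * ?M ^ 2 - ?M) = 0"
    by algebra
  then show ?thesis by simp
qed

section \<open>Appending a symbol to a Motzkin word\<close>

definition successors :: "nat \<Rightarrow> nat set" where
  "successors i = {1..i + 1} - {i}"

lemma motzkin_words_1: "motzkin_words 1 = {[1]}"
  by (auto simp: motzkin_words_def motzkin_word_def length_Suc_conv)

lemma last_motzkin_word_pos:
  assumes "motzkin_word w"
  shows "last w \<ge> 1"
proof (cases "length w = 1")
  case True
  then show ?thesis using assms by (simp add: motzkin_word_def last_conv_nth)
next
  case False
  with assms have "1 \<le> length w - 1" "length w - 1 < length w"
    by (cases w; simp add: motzkin_word_def Suc_le_eq)+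
  with assms have "1 \<le> w ! (length w - 1)"
    unfolding motzkin_word_def by blast
  with assms show ?thesis by (simp add: motzkin_word_def last_conv_nth)
qed

lemma motzkin_word_snoc:
  assumes "w \<noteq> []"
  shows "motzkin_word (w @ [j]) \<longleftrightarrow> motzkin_word w \<and> j \<in> successors (last w)"
proof -
  have "motzkin_word (w @ [j]) \<longleftrightarrow> w ! 0 = 1 \<and>
     (\<forall>k. 1 \<le> k \<and> k < length w \<longrightarrow>
        1 \<le> w ! k \<and> w ! k \<le> w ! (k - 1) + 1 \<and> w ! (k - 1) \<noteq> w ! k) \<and>
     1 \<le> j \<and> j \<le> last w + 1 \<and> last w \<noteq> j"
    using assms
    by (auto simp: motzkin_word_def nth_append last_conv_nth less_Suc_eq all_conj_distrib
        imp_conjR Suc_le_eq)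
  then show ?thesis
    using assms by (auto simp: motzkin_word_def successors_def)
qed

text \<open>
  For length 0 the recursion fails: the empty list is not a Motzkin word, while \<open>[1]\<close> is.
\<close>

lemma sum_motzkin_words_Suc:
  fixes F :: "nat \<Rightarrow> 'a :: comm_monoid_add"
  assumes "n \<ge> 1"
  shows "(\<Sum>w\<in>motzkin_words (Suc n). F (last w))
           = (\<Sum>w\<in>motzkin_words n. \<Sum>j\<in>successors (last w). F j)"
proof -
  let ?S = "SIGMA w:motzkin_words n. successors (last w)"
  have "bij_betw (\<lambda>(w, j). w @ [j]) ?S (motzkin_words (Suc n))"
  proof (rule bij_betwI')
    fix v assume v: "v \<in> motzkin_words (Suc n)"
    then have "v = butlast v @ [last v]" "butlast v \<noteq> []"
      using assms by (cases v rule: rev_cases; force simp: motzkin_words_def)+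
    with v show "\<exists>p\<in>?S. v = (case p of (w, j) \<Rightarrow> w @ [j])"
      using motzkin_word_snoc[of "butlast v" "last v"]
      by (intro bexI[of _ "(butlast v, last v)"]) (auto simp: motzkin_words_def)
  next
    fix p assume p: "p \<in> ?S"
    then obtain w j where "p = (w, j)" "w \<noteq> []" "motzkin_word w" "length w = n"
        "j \<in> successors (last w)"
      by (auto simp: motzkin_words_def motzkin_word_def)
    then show "(case p of (w, j) \<Rightarrow> w @ [j]) \<in> motzkin_words (Suc n)"
      by (simp add: motzkin_words_def motzkin_word_snoc)
  qed auto
  then have "(\<Sum>w\<in>motzkin_words (Suc n). F (last w)) = (\<Sum>(w, j)\<in>?S. F j)"
    by (subst sum.reindex_bij_betw[symmetric]) (auto simp: case_prod_unfold)
  also have "\<dots> = (\<Sum>w\<in>motzkin_words n. \<Sum>j\<in>successors (last w). F j)"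
    by (subst sum.Sigma) (auto simp: finite_motzkin_words successors_def)
  finally show ?thesis .
qed

section \<open>Counting continuations by their length\<close>

text \<open>
  This is the solution of the system that the generating functions of continuations satisfy, in
  closed form. The exponent makes it meaningful for \<open>i \<ge> 1\<close> only.
\<close>

definition continuation_fps :: "nat \<Rightarrow> real fps" where
  "continuation_fps i = motzkin_fps * (1 + fps_X * motzkin_fps) ^ (i - 1)"

text \<open>
  With $r = 1 + xM$, the geometric sum $x \sum_{j=1}^{i+1} M r^{j-1}$ is $r^{i+1} - 1$, since
  $xM = r - 1$. Omitting $j = i$ leaves $r^{i-1} (r^2 - xM)$ on the right-hand side, and
  $r^2 - xM = 1 + xM + x^2M^2 = M$ by the functional equation.
\<close>

lemma continuation_fps_recursion:
  assumes "i \<ge> 1"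
  shows "continuation_fps i = 1 + fps_X * (\<Sum>j\<in>successors i. continuation_fps j)"
proof -
  let ?M = motzkin_fps and ?X = "fps_X :: real fps"
  define r where "r = 1 + ?X * ?M"
  obtain m where i: "i = Suc m" using assms by (cases i) auto
  have telescope: "?X * (\<Sum>j\<in>{1..n}. continuation_fps j) = r ^ n - 1" for n
    by (induction n) (simp_all add: continuation_fps_def r_def algebra_simps)
  have "(\<Sum>j\<in>successors i. continuation_fps j)
      = (\<Sum>j\<in>{1..i+1}. continuation_fps j) - continuation_fps i"
    unfolding successors_def using assms by (subst sum_diff1) auto
  then have "1 + ?X * (\<Sum>j\<in>successors i. continuation_fps j) 
      = r ^ (i + 1) - ?X * continuation_fps i"
    using telescope[of "i + 1"] by (simp only: right_diff_distrib) simp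
  also have "\<dots> = r ^ m * (r ^ 2 - ?X * ?M)"
    by (simp add: continuation_fps_def i algebra_simps power2_eq_square flip: r_def)
  also have "r ^ 2 - ?X * ?M = 1 + ?X * ?M + ?X ^ 2 * ?M ^ 2"
    by (simp add: r_def power2_eq_square algebra_simps)
  also have "\<dots> = ?M"
    using motzkin_fps_equation by simp
  also have "r ^ m * ?M = continuation_fps i"
    by (simp add: continuation_fps_def i r_def)
  finally show ?thesis by simp
qed

lemma continuation_fps_nth_Suc:
  assumes "i \<ge> 1"
  shows "fps_nth (continuation_fps i) (Suc n) = (\<Sum>j\<in>successors i. fps_nth (continuation_fps j) n)"
  by (subst continuation_fps_recursion[OF assms]) (simp add: fps_sum_nth)

lemma continuation_fps_nth_0: "i \<ge> 1 \<Longrightarrow> fps_nth (continuation_fps i) 0 = 1"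
  by (subst continuation_fps_recursion) simp_all

text \<open>
  This is where the weight \<open>i\<close> in the sum of last symbols comes from: it counts the successors.
\<close>

lemma continuation_fps_nth_1:
  assumes "i \<ge> 1"
  shows "fps_nth (continuation_fps i) 1 = real i"
proof -
  have "fps_nth (continuation_fps i) 1 = (\<Sum>j\<in>successors i. 1)"
    unfolding One_nat_def continuation_fps_nth_Suc[OF assms]
    by (intro sum.cong) (auto simp: successors_def continuation_fps_nth_0)
  also have "\<dots> = real i"
    using assms by (simp add: successors_def)
  finally show ?thesis .
qed

text \<open>
  Both sides count the Motzkin words of length $m + n + 1$, on the left by their prefix of
  length $m + 1$. The induction moves one symbol at a time from the continuation to the prefix.
\<close>

lemma sum_continuations:
  "(\<Sum>w\<in>motzkin_words (Suc m). fps_nth (continuation_fps (last w)) n) = fps_nth motzkin_fps (m + n)"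
proof (induction m arbitrary: n)
  case 0
  then show ?case
    using motzkin_words_1 by (simp add: continuation_fps_def)
next
  case (Suc m)
  have "(\<Sum>w\<in>motzkin_words (Suc (Suc m)). fps_nth (continuation_fps (last w)) n)
      = (\<Sum>w\<in>motzkin_words (Suc m). \<Sum>j\<in>successors (last w). fps_nth (continuation_fps j) n)"
    by (rule sum_motzkin_words_Suc) simp
  also have "\<dots> = (\<Sum>w\<in>motzkin_words (Suc m). fps_nth (continuation_fps (last w)) (Suc n))"
    by (intro sum.cong refl continuation_fps_nth_Suc[symmetric] last_motzkin_word_pos)
       (simp add: motzkin_words_def)
  also have "\<dots> = fps_nth motzkin_fps (Suc m + n)"
    using Suc.IH[of "Suc n"] by simp
  finally show ?case .
qed

lemma last_symbol_sum_conv_motzkin_fps: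
  assumes "n \<ge> 1"
  shows "real (last_symbol_sum n) = fps_nth motzkin_fps n"
proof -
  obtain m where n: "n = Suc m" using assms by (cases n) auto
  have "real (last_symbol_sum n) = (\<Sum>w\<in>motzkin_words n. fps_nth (continuation_fps (last w)) 1)"
    unfolding last_symbol_sum_def of_nat_sum
    by (intro sum.cong refl continuation_fps_nth_1[symmetric] last_motzkin_word_pos)
       (simp add: motzkin_words_def)
  with sum_continuations[where m = m and n = 1] n show ?thesis by simp
qed

lemma last_symbol_gf_conv_motzkin_fps: "last_symbol_gf = motzkin_fps - 1"
proof -
  have "fps_nth motzkin_fps 0 = 1"
    by (subst motzkin_fps_equation) (simp add: power2_eq_square)
  then show ?thesis
    by (auto simp: fps_eq_iff last_symbol_gf_def last_symbol_sum_conv_motzkin_fps not_le)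
qed

lemma fls_last_symbol_gf:
  "fps_to_fls last_symbol_gf
     = (1 - fls_X - 2 * fls_X ^ 2 - fps_to_fls motzkin_sqrt) / (2 * fls_X ^ 2)"
proof -
  have "motzkin_sqrt = 1 - fps_X - 2 * fps_X ^ 2 * (last_symbol_gf + 1)"
    using motzkin_sqrt_conv_motzkin_fps by (simp add: last_symbol_gf_conv_motzkin_fps)
  then have "fps_to_fls motzkin_sqrt
      = fps_to_fls (1 - fps_X - 2 * fps_X ^ 2 * (last_symbol_gf + 1))"
    by (rule arg_cong)
  then have "fps_to_fls motzkin_sqrt
      = 1 - fls_X - 2 * fls_X ^ 2 * (fps_to_fls last_symbol_gf + 1)"
    by (simp add: fls_times_fps_to_fls fps_to_fls_power)
  then show ?thesis
    by (simp add: field_simps)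
qed

section \<open>Convolutions with a power law\<close>

lemma tendsto_powr_shift:
  fixes a :: "nat \<Rightarrow> real"
  assumes "(\<lambda>n. real n powr p * a n) \<longlonglongrightarrow> L"
  shows "(\<lambda>n. real (n + k) powr p * a n) \<longlonglongrightarrow> L"
proof (rule Lim_transform_eventually)
  have "(\<lambda>n. (real (n + k) / real n) powr p) \<longlonglongrightarrow> 1"
    by real_asymp
  from tendsto_mult[OF this assms]
  show "(\<lambda>n. (real (n + k) / real n) powr p * (real n powr p * a n)) \<longlonglongrightarrow> L" by simp
  show "\<forall>\<^sub>F n in sequentially. (real (n + k) / real n) powr p * (real n powr p * a n)
      = real (n + k) powr p * a n"
    using eventually_gt_at_top[of 0]
    by eventually_elim (simp add: powr_divide)
qed

text \<open>
  The weight is taken at \<open>n + 1\<close> so that the bound also controls \<open>a 0\<close>.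
\<close>

lemma powr_weight_bounded:
  fixes a :: "nat \<Rightarrow> real"
  assumes "(\<lambda>n. real n powr p * a n) \<longlonglongrightarrow> L"
  shows "\<exists>K. \<forall>n. real (n + 1) powr p * \<bar>a n\<bar> \<le> K"
proof -
  have "Bseq (\<lambda>n. real (n + 1) powr p * a n)"
    using tendsto_powr_shift[OF assms, of 1] by (rule convergentI[THEN convergent_imp_Bseq])
  then show ?thesis
    by (auto simp: Bseq_def abs_mult)
qed

text \<open>
  For fixed $k$ the summand $n^p b_k a_{n-k}$ tends to $b_k L$. Since $n \le (k+1)(n-k+1)$, its
  absolute value is at most $(k+1)^p |b_k|$ times a bound for $(m+1)^p |a_m|$. This majorant is
  summable in $k$ and does not depend on $n$, so Tannery's theorem allows summing the limits.
\<close>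

lemma tendsto_powr_convolution:
  fixes a b :: "nat \<Rightarrow> real"
  assumes a: "(\<lambda>n. real n powr p * a n) \<longlonglongrightarrow> L" and "p \<ge> 0"
    and b: "summable (\<lambda>k. real (k + 1) powr p * \<bar>b k\<bar>)"
  shows "(\<lambda>n. real n powr p * (\<Sum>k\<le>n. b k * a (n - k))) \<longlonglongrightarrow> suminf b * L"
proof -
  obtain K where K: "\<And>n. real (n + 1) powr p * \<bar>a n\<bar> \<le> K"
    using powr_weight_bounded[OF a] by blast
  define f where "f = (\<lambda>k n. if k \<le> n then real n powr p * (b k * a (n - k)) else 0)"
  have limit: "(\<lambda>n. f k n) \<longlonglongrightarrow> b k * L" for k
  proof (rule LIMSEQ_offset[where k = k])
    show "(\<lambda>n. f k (n + k)) \<longlonglongrightarrow> b k * L"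
      using tendsto_mult[OF tendsto_const[of "b k"] tendsto_powr_shift[OF a, of k]]
      by (simp add: f_def algebra_simps)
  qed
  have bound: "norm (f k n) \<le> real (k + 1) powr p * \<bar>b k\<bar> * K" for k n
  proof (cases "k \<le> n")
    case True
    obtain m where "n = k + m" using True le_Suc_ex by blast
    then have "real n \<le> real (k + 1) * real (n - k + 1)"
      by (simp add: algebra_simps)
    then have "real n powr p \<le> (real (k + 1) * real (n - k + 1)) powr p"
      using \<open>p \<ge> 0\<close> by (intro powr_mono2) auto
    also have "\<dots> = real (k + 1) powr p * real (n - k + 1) powr p"
      by (rule powr_mult)
    finally have "norm (f k n)
        \<le> real (k + 1) powr p * real (n - k + 1) powr p * (\<bar>b k\<bar> * \<bar>a (n - k)\<bar>)"
      using True by (simp add: f_def abs_mult mult_right_mono)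
    also have "\<dots> = real (k + 1) powr p * \<bar>b k\<bar> * (real (n - k + 1) powr p * \<bar>a (n - k)\<bar>)"
      by simp
    also have "\<dots> \<le> real (k + 1) powr p * \<bar>b k\<bar> * K"
      by (intro mult_left_mono K) simp
    finally show ?thesis .
  next
    case False
    have "K \<ge> 0" using order_trans[OF _ K[of 0]] by simp
    with False show ?thesis by (simp add: f_def)
  qed
  have "eventually (\<lambda>(k, n). norm (f k n) \<le> real (k + 1) powr p * \<bar>b k\<bar> * K)
      (at_top \<times>\<^sub>F sequentially)"
    using bound by (intro always_eventually) auto
  from tannerys_theorem[OF limit this summable_mult2[OF b]]
  have "(\<lambda>n. \<Sum>k. f k n) \<longlonglongrightarrow> (\<Sum>k. b k * L)"
    by simp
  moreover have "(\<Sum>k. f k n) = real n powr p * (\<Sum>k\<le>n. b k * a (n - k))" for n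
    by (subst suminf_finite[of "{..n}"]) (auto simp: f_def sum_distrib_left)
  moreover have "(\<Sum>k. b k * L) = suminf b * L"
  proof (rule suminf_mult2[symmetric], rule summable_comparison_test'[OF b])
    fix k :: nat
    have "1 * \<bar>b k\<bar> \<le> real (k + 1) powr p * \<bar>b k\<bar>"
      using \<open>p \<ge> 0\<close> by (intro mult_right_mono ge_one_powr_ge_zero) auto
    then show "norm (b k) \<le> real (k + 1) powr p * \<bar>b k\<bar>" by simp
  qed
  ultimately show ?thesis by simp
qed

section \<open>Asymptotics of the coefficients\<close>

text \<open>The constant is $1 / \Gamma(-1/2)$.\<close>

lemma gbinomial_half_asymptotic:
  "(\<lambda>n. real n powr (3/2) * ((-1) ^ n * ((1/2) gchoose n))) \<longlonglongrightarrow> - 1 / (2 * sqrt pi)"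
proof (rule Lim_transform_eventually)
  have "- (1 / 2 :: real) \<notin> \<int>\<^sub>\<le>\<^sub>0"
  proof
    assume "- (1 / 2 :: real) \<in> \<int>\<^sub>\<le>\<^sub>0"
    then obtain m where "- (1 / 2 :: real) = of_int m"
      by (auto elim: nonpos_Ints_cases)
    then have "of_int (2 * m) = (of_int (- 1) :: real)" by simp
    then have "2 * m = - 1" by (simp only: of_int_eq_iff)
    then show False by presburger
  qed
  then have "Gamma (- 1 / 2 :: real) = - 2 * sqrt pi"
    using Gamma_plus1[of "- 1 / 2 :: real"] Gamma_one_half_real by simp
  then show "(\<lambda>n. ((1/2) gchoose n) / ((-1) ^ n / exp ((1/2 + 1) * of_real (ln (real n)))))
      \<longlonglongrightarrow> - 1 / (2 * sqrt pi)"
    using gbinomial_asymptotic[of "1/2 :: real"] by (simp add: field_simps)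
  show "\<forall>\<^sub>F n in sequentially. ((1/2) gchoose n) / ((-1) ^ n / exp ((1/2 + 1) * of_real (ln (real n))))
      = real n powr (3/2) * ((-1) ^ n * ((1/2) gchoose n))"
    using eventually_gt_at_top[of 0]
    by eventually_elim (simp add: powr_def field_simps minus_one_power_iff)
qed

text \<open>
  This is $1 - 2x - 3x^2 = (1 + x)(1 - 3x)$ for square roots. Both sides have the same square, and
  their constant terms exclude opposite signs.
\<close>

lemma motzkin_sqrt_factorization:
  "motzkin_sqrt = fps_binomial (1/2) * (fps_binomial (1/2) oo (fps_const (-3) * fps_X))"
    (is "_ = ?B * ?A")
proof -
  have B: "?B ^ 2 = 1 + fps_X"
    by (simp add: fps_binomial_power fps_binomial_1)
  have A: "?A ^ 2 = 1 - 3 * fps_X"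
    by (simp add: B fps_compose_power fps_compose_add_distrib numeral_fps_const
        flip: fps_const_neg)
  have "motzkin_sqrt ^ 2 = (?B * ?A) ^ 2"
    unfolding motzkin_sqrt_square power_mult_distrib A B
    by (simp add: algebra_simps power2_eq_square)
  then have "motzkin_sqrt = ?B * ?A \<or> motzkin_sqrt = - (?B * ?A)"
    by (rule power2_eq_iff[THEN iffD1])
  moreover have "motzkin_sqrt \<noteq> - (?B * ?A)"
  proof
    assume "motzkin_sqrt = - (?B * ?A)"
    then have "fps_nth motzkin_sqrt 0 = fps_nth (- (?B * ?A)) 0" by (rule arg_cong)
    then show False by (simp add: motzkin_sqrt_nth_0)
  qed
  ultimately show ?thesis by blast
qed

text \<open>
  The singularity of $\sqrt{1 - 3x}$ at $1/3$ dominates, and the other factor contributes its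
  value $2/\sqrt 3$ at that point.
\<close>

lemma motzkin_sqrt_asymptotic:
  "(\<lambda>n. real n powr (3/2) * (fps_nth motzkin_sqrt n / 3 ^ n)) \<longlonglongrightarrow> - 1 / sqrt (3 * pi)"
proof -
  define a where "a = (\<lambda>n. (-1) ^ n * ((1/2 :: real) gchoose n))"
  define b where "b = (\<lambda>n. ((1/2 :: real) gchoose n) * (1/3) ^ n)"
  have a: "(\<lambda>n. real n powr (3/2) * a n) \<longlonglongrightarrow> - 1 / (2 * sqrt pi)"
    unfolding a_def by (rule gbinomial_half_asymptotic)
  have b: "summable (\<lambda>k. real (k + 1) powr (3/2) * \<bar>b k\<bar>)"
  proof -
    obtain K where K: "\<And>n. real (n + 1) powr (3/2) * \<bar>a n\<bar> \<le> K"
      using powr_weight_bounded[OF a] by blast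
    show ?thesis
    proof (rule summable_comparison_test'[where N = 0])
      show "summable (\<lambda>k. K * (1/3) ^ k)"
        by (intro summable_mult summable_geometric) simp
      show "norm (real (k + 1) powr (3/2) * \<bar>b k\<bar>) \<le> K * (1/3) ^ k" for k
        using mult_right_mono[OF K[of k], of "(1/3) ^ k"]
        by (simp add: a_def b_def abs_mult power_abs mult.assoc)
    qed
  qed
  have suminf_b: "suminf b = 2 / sqrt 3"
  proof -
    have "b sums (1 + 1/3) powr (1/2)"
      unfolding b_def by (rule gen_binomial_real) simp
    then show ?thesis
      by (simp add: sums_iff powr_half_sqrt real_sqrt_divide)
  qed
  \<comment> \<open>The factor \<open>1 / 3 ^ n\<close> is split as \<open>1 / 3 ^ k\<close> times \<open>1 / 3 ^ (n - k)\<close>.\<close>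
  have "fps_nth motzkin_sqrt n / 3 ^ n = (\<Sum>k\<le>n. b k * a (n - k))" for n
  proof -
    have "b k * a (n - k) = ((1/2) gchoose k) * ((-3) ^ (n - k) * ((1/2) gchoose (n - k))) / 3 ^ n"
      if "k \<le> n" for k
    proof -
      have "(3::real) ^ n = 3 ^ k * 3 ^ (n - k)"
        using that by (simp flip: power_add)
      moreover have "(-3 :: real) ^ (n - k) = (-1) ^ (n - k) * 3 ^ (n - k)"
        by (simp flip: power_mult_distrib)
      ultimately show ?thesis
        by (simp add: a_def b_def power_divide)
    qed
    then show ?thesis
      by (simp add: motzkin_sqrt_factorization fps_mult_nth atLeast0AtMost sum_divide_distrib)
  qed
  then show ?thesis
    using tendsto_powr_convolution[OF a _ b] by (simp add: suminf_b real_sqrt_mult)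
qed

lemma last_symbol_sum_conv_motzkin_sqrt:
  assumes "n \<ge> 1"
  shows "real (last_symbol_sum n) = - fps_nth motzkin_sqrt (n + 2) / 2"
  using assms by (simp add: last_symbol_sum_conv_motzkin_fps motzkin_fps_def)

lemma last_symbol_sum_asymptotic:
  "(\<lambda>n. real (last_symbol_sum n)) \<sim>[sequentially]
     (\<lambda>n. 3 * sqrt 3 * (1 / real n) powr (3 / 2) * 3 ^ n / (2 * sqrt pi))"
proof (rule asymp_equivI'_const[where c = 1, simplified])
  show "(\<lambda>n. real (last_symbol_sum n) /
      (3 * sqrt 3 * (1 / real n) powr (3 / 2) * 3 ^ n / (2 * sqrt pi))) \<longlonglongrightarrow> 1"
  proof (rule Lim_transform_eventually)
    \<comment> \<open>The shift by 2 contributes $3^2$ and the conversion to last symbols $-1/2$, so the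
      limit $-1/\sqrt{3\pi}$ becomes $9 / (2\sqrt{3\pi}) = 3\sqrt3 / (2\sqrt\pi)$.\<close>
    let ?s = "\<lambda>n. real (n + 2) powr (3/2) * (fps_nth motzkin_sqrt (n + 2) / 3 ^ (n + 2))"
    have "?s \<longlonglongrightarrow> - 1 / sqrt (3 * pi)"
      by (rule LIMSEQ_ignore_initial_segment[OF motzkin_sqrt_asymptotic])
    moreover have "(\<lambda>n. (real n / real (n + 2)) powr (3/2)) \<longlonglongrightarrow> 1"
      by real_asymp
    ultimately have "(\<lambda>n. (real n / real (n + 2)) powr (3/2) * ?s n * (- sqrt (3 * pi)))
        \<longlonglongrightarrow> 1 * (- 1 / sqrt (3 * pi)) * (- sqrt (3 * pi))"
      by (intro tendsto_intros)
    then show "(\<lambda>n. (real n / real (n + 2)) powr (3/2) * ?s n * (- sqrt (3 * pi))) \<longlonglongrightarrow> 1"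
      by simp
    show "\<forall>\<^sub>F n in sequentially. (real n / real (n + 2)) powr (3/2) * ?s n * (- sqrt (3 * pi))
        = real (last_symbol_sum n) /
          (3 * sqrt 3 * (1 / real n) powr (3 / 2) * 3 ^ n / (2 * sqrt pi))"
      using eventually_gt_at_top[of 0]
    proof eventually_elim
      case (elim n)
      have "(real n / real (n + 2)) powr (3/2) * real (n + 2) powr (3/2) = real n powr (3/2)"
        using elim by (simp flip: powr_mult)
      then have "(real n / real (n + 2)) powr (3/2) * ?s n * (- sqrt (3 * pi))
          = real n powr (3/2) * (fps_nth motzkin_sqrt (n + 2) / 3 ^ (n + 2)) * (- sqrt (3 * pi))"
        by simp
      also have "\<dots> = real (last_symbol_sum n) /
          (3 * sqrt 3 * (1 / real n) powr (3 / 2) * 3 ^ n / (2 * sqrt pi))"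
        using elim
        by (simp add: last_symbol_sum_conv_motzkin_sqrt powr_divide real_sqrt_mult field_simps)
      finally show ?case .
    qed
  qed
qed

theorem corollary3p3:
  shows "fps_to_fls last_symbol_gf
           = (1 - fls_X - 2 * fls_X ^ 2 - fps_to_fls motzkin_sqrt) / (2 * fls_X ^ 2)
         \<and> (\<lambda>n. real (last_symbol_sum n))
             \<sim>[sequentially]
           (\<lambda>n. 3 * sqrt 3 * (1 / real n) powr (3 / 2) * 3 ^ n / (2 * sqrt pi))"
  using fls_last_symbol_gf last_symbol_sum_asymptotic by blast

end
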